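(* Let $s\in(0,1)$ and let $K:\mathbb R^d\times\mathbb R^d\to\mathbb R$ be a measurable kernel such that for all $v\in\mathbb R^d$ and $r>0$ $$\int_{\mathbb R^d\setminus B_r(v)}|K(v,v')|\,dv'\le\Lambda r^{-2s},\qquad\int_{\mathbb R^d\setminus B_r(v)}|K(v',v)|\,dv'\le\Lambda r^{-2s}.$$ Then there exists a constant $C$ depending only on $\Lambda$, $s$ and the dimension $d$ such that for any function $g\in H^s(\mathbb R^d)$, $$\mathcal E^{\mathrm{sym}}(g,g)\le C\|g\|_{\dot H^s}^2.$$
   Context: $B_r(v)$ is the ball of radius $r$ centered at $v$. Here $$\mathcal E^{\mathrm{sym}}(\varphi,g)=\frac12\iint_{\mathbb R^d\times\mathbb R^d}(\varphi(v)-\varphi(v'))(g(v)-g(v'))K(v,v')\,dv'\,dv,\qquad\|g\|_{\dot H^s}^2=\iint_{\mathbb R^d\times\mathbb R^d}\frac{|g(v')-g(v)|^2}{|v-v'|^{d+2s}}\,dv'\,dv.$$ *)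

theory Defs
  imports "HOL-Analysis.Analysis"
begin

text \<open>
  Double integrals over \<open>\<real>\<^sup>d \<times> \<real>\<^sup>d\<close> are Lebesgue integrals on the product space, and
  measurability means Lebesgue measurability.  The Bochner integral of a non-integrable function is 0
  by convention, so the integrability of each integrand is recorded as a separate predicate.
\<close>

definition Esym_integrand ::
  "(real^'n \<Rightarrow> real^'n \<Rightarrow> real) \<Rightarrow> (real^'n \<Rightarrow> real) \<Rightarrow> (real^'n \<Rightarrow> real) \<Rightarrow> (real^'n) \<times> (real^'n) \<Rightarrow> real"
  where "Esym_integrand K \<phi> g = (\<lambda>(v, v'). (\<phi> v - \<phi> v') * (g v - g v') * K v v')"

definition Esym_defined ::
  "(real^'n \<Rightarrow> real^'n \<Rightarrow> real) \<Rightarrow> (real^'n \<Rightarrow> real) \<Rightarrow> (real^'n \<Rightarrow> real) \<Rightarrow> bool"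
  where "Esym_defined K \<phi> g \<longleftrightarrow> integrable lebesgue (Esym_integrand K \<phi> g)"

definition Esym ::
  "(real^'n \<Rightarrow> real^'n \<Rightarrow> real) \<Rightarrow> (real^'n \<Rightarrow> real) \<Rightarrow> (real^'n \<Rightarrow> real) \<Rightarrow> real"
  where "Esym K \<phi> g = 1 / 2 * (LINT p|lebesgue. Esym_integrand K \<phi> g p)"

text \<open>On the diagonal the integrand below is \<open>0 / 0 = 0\<close>; the diagonal is a null set.\<close>

definition Hdot_integrand :: "real \<Rightarrow> (real^'n \<Rightarrow> real) \<Rightarrow> (real^'n) \<times> (real^'n) \<Rightarrow> real"
  where "Hdot_integrand s g =
    (\<lambda>(v, v'). \<bar>g v' - g v\<bar>\<^sup>2 / norm (v - v') powr (real CARD('n) + 2 * s))"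

definition Hdot_norm :: "real \<Rightarrow> (real^'n \<Rightarrow> real) \<Rightarrow> real"
  where "Hdot_norm s g = sqrt (LINT p|lebesgue. Hdot_integrand s g p)"

text \<open>\<open>H\<^sup>s(\<real>\<^sup>d)\<close> for \<open>0 < s < 1\<close>: square-integrable functions with finite \<open>Hdot_norm\<close>.\<close>

definition Hs :: "real \<Rightarrow> (real^'n \<Rightarrow> real) set"
  where "Hs s = {g. g \<in> borel_measurable lebesgue \<and> integrable lebesgue (\<lambda>v. (g v)\<^sup>2) \<and>
                    integrable lebesgue (Hdot_integrand s g)}"

text \<open>
  The integrals here are \<open>[0, \<infinity>]\<close>-valued, so the bounds include finiteness.  For \<open>\<Lambda> < 0\<close>, where the
  bounds would be unsatisfiable, \<open>ennreal\<close> truncates the right-hand sides to 0.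
\<close>

definition kernel_bounds :: "real \<Rightarrow> real \<Rightarrow> (real^'n \<Rightarrow> real^'n \<Rightarrow> real) \<Rightarrow> bool"
  where "kernel_bounds s \<Lambda> K \<longleftrightarrow> (\<forall>v. \<forall>r>0.
    (\<integral>\<^sup>+v'\<in>- ball v r. ennreal \<bar>K v v'\<bar> \<partial>lebesgue) \<le> ennreal (\<Lambda> * r powr (- 2 * s)) \<and>
    (\<integral>\<^sup>+v'\<in>- ball v r. ennreal \<bar>K v' v\<bar> \<partial>lebesgue) \<le> ennreal (\<Lambda> * r powr (- 2 * s)))"

end

theory Submission
  imports Defs
begin

text \<open>
  The kernel is only controlled in average, so \<open>(g v - g v')\<^sup>2\<close> is first averaged: for \<open>z\<close> in the ball
  of radius \<open>\<bar>v - v'\<bar> / 2\<close> about the midpoint of \<open>v\<close> and \<open>v'\<close> it is at most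
  \<open>2 (g v - g z)\<^sup>2 + 2 (g v' - g z)\<^sup>2\<close>.  By Tonelli the first term contributes
  \<open>(g v - g z)\<^sup>2\<close> times the integral of \<open>\<bar>K v v'\<bar> \<bar>v - v'\<bar>\<^sup>-\<^sup>d\<close> over \<open>v'\<close> outside the ball of
  radius \<open>\<bar>v - z\<bar>\<close> about \<open>v\<close>, which is at most \<open>\<Lambda> \<bar>v - z\<bar>\<^sup>-\<^sup>d\<^sup>-\<^sup>2\<^sup>s\<close>; the second term is symmetric.
\<close>

section \<open>Null sets in the product space\<close>

text \<open>If \<open>P\<close> holds off a null set \<open>N\<close>, the exceptional pairs lie in
  \<open>N \<times> UNIV\<close> or \<open>UNIV \<times> N\<close>, both null. This allows a
  function to be replaced by a Borel representative in both variables of a double integral.\<close>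

lemma lborel_AE_pair_fst_snd:
  fixes P :: "'a::euclidean_space \<Rightarrow> bool"
  assumes "AE x in lborel. P x"
  shows "AE p in (lborel :: ('a \<times> 'a) measure). P (fst p) \<and> P (snd p)"
proof -
  obtain N where N: "N \<in> sets borel" "emeasure lborel N = 0" "{x. \<not> P x} \<subseteq> N"
    using AE_E[OF assms] by auto
  have "AE x in lborel. x \<notin> N"
    using N by (intro AE_not_in) auto
  moreover have "{p \<in> space (lborel \<Otimes>\<^sub>M lborel). fst p \<notin> N \<and> snd p \<notin> N} = (- N) \<times> (- N)"
    by (auto simp: space_pair_measure)
  ultimately have "AE p in (lborel \<Otimes>\<^sub>M lborel :: ('a \<times> 'a) measure). fst p \<notin> N \<and> snd p \<notin> N"
    using N(1) by (intro lborel_pair.AE_pair_measure) auto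
  then show ?thesis
    unfolding lborel_prod by eventually_elim (use N(3) in auto)
qed

text \<open>The flip of coordinates preserves the product measure. It is needed because
  \<open>AE_pair\<close> slices along the first coordinate only, while the kernel is bounded in each
  of its two arguments.\<close>

lemma lborel_AE_pair_swap:
  fixes P :: "'a::euclidean_space \<times> 'a \<Rightarrow> bool"
  assumes "AE p in lborel \<Otimes>\<^sub>M lborel. P p"
  shows "AE p in lborel \<Otimes>\<^sub>M lborel. P (snd p, fst p)"
proof -
  have "AE p in distr (lborel \<Otimes>\<^sub>M lborel) (lborel \<Otimes>\<^sub>M lborel) (\<lambda>(x, y). (y, x)). P p"
    using assms lborel_pair.distr_pair_swap by metis
  from AE_distrD[OF measurable_pair_swap' this] show ?thesis
    by (simp add: split_beta)
qed

section \<open>Averaging estimate for Borel functions\<close>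

text \<open>After the order of integration is exchanged, the condition on \<open>z\<close> becomes
  the condition that \<open>y\<close> lies outside \<open>ball x (norm (x - z))\<close>. There the
  weight is at most \<open>norm (x - z) powr (- d)\<close>, and only the tail of
  \<open>\<kappa>\<close> remains. A one-variable \<open>\<kappa>\<close> lets the lemma serve both
  slots of the kernel.\<close>

lemma nn_integral_weighted_cball_le:
  fixes x :: "'a::euclidean_space" and f \<kappa> :: "'a \<Rightarrow> ennreal"
  assumes [measurable]: "f \<in> borel_measurable borel" "\<kappa> \<in> borel_measurable borel"
    and bound: "\<And>r. r > 0 \<Longrightarrow> (\<integral>\<^sup>+y\<in>- ball x r. \<kappa> y \<partial>lborel) \<le> L * ennreal (r powr (- 2 * s))"
    and "d \<ge> 0"
  shows "(\<integral>\<^sup>+y. \<kappa> y * (ennreal (norm (x - y) powr (- d)) *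
             (\<integral>\<^sup>+z\<in>cball x (norm (x - y)). f z \<partial>lborel)) \<partial>lborel)
       \<le> L * (\<integral>\<^sup>+z. f z * ennreal (norm (x - z) powr (- (d + 2 * s))) \<partial>lborel)"
proof -
  define w where "w y = ennreal (norm (x - y) powr (- d))" for y
  \<comment> \<open>As a comparison of norms, the indicator of the moving ball is jointly measurable
    in \<open>y\<close> and \<open>z\<close>, as Tonelli requires.\<close>
  define I :: "'a \<Rightarrow> 'a \<Rightarrow> ennreal" where "I y z = (if norm (x - z) \<le> norm (x - y) then 1 else 0)" for y z
  have [measurable]: "w \<in> borel_measurable borel"
    unfolding w_def by measurable
  have [measurable]: "case_prod I \<in> borel_measurable (borel \<Otimes>\<^sub>M borel)"
    unfolding I_def by measurable
  have ind: "indicator (cball x (norm (x - y))) z = I y z" for y z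
    by (auto simp: I_def indicator_def dist_norm)
  have "(\<integral>\<^sup>+y. \<kappa> y * (w y * (\<integral>\<^sup>+z\<in>cball x (norm (x - y)). f z \<partial>lborel)) \<partial>lborel)
      = (\<integral>\<^sup>+y. \<integral>\<^sup>+z. f z * (\<kappa> y * w y * I y z) \<partial>lborel \<partial>lborel)"
    by (simp add: ind nn_integral_cmult[symmetric] mult_ac)
  also have "\<dots> = (\<integral>\<^sup>+z. \<integral>\<^sup>+y. f z * (\<kappa> y * w y * I y z) \<partial>lborel \<partial>lborel)"
    by (intro lborel_pair.Fubini') measurable
  also have "\<dots> \<le> (\<integral>\<^sup>+z. L * (f z * ennreal (norm (x - z) powr (- (d + 2 * s)))) \<partial>lborel)"
  \<comment> \<open>The point \<open>z = x\<close> must be excluded: it offers no positive radius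
    for \<open>bound\<close>, and the right-hand side is 0 there because
    \<open>0 powr a = 0\<close>.\<close>
  proof (rule nn_integral_mono_AE, use AE_lborel_singleton[of x] in eventually_elim)
    fix z assume "z \<noteq> x"
    define r where "r = norm (x - z)"
    have r: "r > 0" using \<open>z \<noteq> x\<close> by (simp add: r_def)
    have "\<kappa> y * w y * I y z \<le> ennreal (r powr (- d)) * (\<kappa> y * indicator (- ball x r) y)" for y
    proof (cases "r \<le> norm (x - y)")
      case True
      then have "w y \<le> ennreal (r powr (- d))"
        unfolding w_def using r \<open>d \<ge> 0\<close> by (intro ennreal_leI powr_mono2') auto
      with True show ?thesis
        by (auto simp: I_def indicator_def dist_norm r_def mult.commute intro!: mult_left_mono)
    qed (auto simp: I_def r_def)
    then have "(\<integral>\<^sup>+y. \<kappa> y * w y * I y z \<partial>lborel)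
        \<le> (\<integral>\<^sup>+y. ennreal (r powr (- d)) * (\<kappa> y * indicator (- ball x r) y) \<partial>lborel)"
      by (intro nn_integral_mono)
    also have "\<dots> = ennreal (r powr (- d)) * (\<integral>\<^sup>+y\<in>- ball x r. \<kappa> y \<partial>lborel)"
      by (intro nn_integral_cmult) measurable
    also have "\<dots> \<le> ennreal (r powr (- d)) * (L * ennreal (r powr (- 2 * s)))"
      by (intro mult_left_mono bound r) auto
    also have "\<dots> = L * ennreal (r powr (- (d + 2 * s)))"
      by (simp add: mult.left_commute[of _ L] ennreal_mult[symmetric] powr_add[symmetric])
    finally have "f z * (\<integral>\<^sup>+y. \<kappa> y * w y * I y z \<partial>lborel)
        \<le> f z * (L * ennreal (r powr (- (d + 2 * s))))"
      by (intro mult_left_mono) auto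
    moreover have "(\<integral>\<^sup>+y. f z * (\<kappa> y * w y * I y z) \<partial>lborel) = f z * (\<integral>\<^sup>+y. \<kappa> y * w y * I y z \<partial>lborel)"
      by (intro nn_integral_cmult) measurable
    ultimately show "(\<integral>\<^sup>+y. f z * (\<kappa> y * w y * I y z) \<partial>lborel)
        \<le> L * (f z * ennreal (norm (x - z) powr (- (d + 2 * s))))"
      by (simp add: r_def mult.left_commute)
  qed
  also have "\<dots> = L * (\<integral>\<^sup>+z. f z * ennreal (norm (x - z) powr (- (d + 2 * s))) \<partial>lborel)"
    by (intro nn_integral_cmult) measurable
  finally show ?thesis
    by (simp add: w_def)
qed

text \<open>The ball of radius \<open>\<bar>x - y\<bar> / 2\<close> about the midpoint lies in both balls on the right.\<close>

lemma sq_diff_le_average: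
  fixes x y :: "'a::euclidean_space" and h :: "'a \<Rightarrow> real"
  assumes [measurable]: "h \<in> borel_measurable borel"
  shows "ennreal ((h x - h y)\<^sup>2)
    \<le> ennreal (2 * 2 ^ DIM('a) / unit_ball_vol DIM('a)) *
      (ennreal (norm (x - y) powr (- real DIM('a))) *
         (\<integral>\<^sup>+z\<in>cball x (norm (x - y)). ennreal ((h x - h z)\<^sup>2) \<partial>lborel) +
       ennreal (norm (x - y) powr (- real DIM('a))) *
         (\<integral>\<^sup>+z\<in>cball y (norm (x - y)). ennreal ((h y - h z)\<^sup>2) \<partial>lborel))"
proof (cases "x = y")
  case False
  define r where "r = norm (x - y)"
  define m where "m = midpoint x y"
  define q where "q = (h x - h y)\<^sup>2"
  define V where "V = unit_ball_vol DIM('a) * (r / 2) ^ DIM('a)"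
  have r: "r > 0" using False by (simp add: r_def)
  have V: "V > 0" unfolding V_def using r by simp
  have [measurable]: "cball x r \<in> sets borel" "cball y r \<in> sets borel"
    by simp_all
  let ?X = "\<lambda>z. ennreal ((h x - h z)\<^sup>2) * indicator (cball x r) z"
  let ?Y = "\<lambda>z. ennreal ((h y - h z)\<^sup>2) * indicator (cball y r) z"
  have "ennreal q * indicator (ball m (r / 2)) z \<le> 2 * ?X z + 2 * ?Y z" for z
  proof (cases "z \<in> ball m (r / 2)")
    case True
    have "dist x m = r / 2" "dist y m = r / 2"
      unfolding m_def r_def by (simp_all add: dist_midpoint flip: dist_norm)
    with True have "dist x z \<le> r" "dist y z \<le> r"
      using dist_triangle[of x z m] dist_triangle[of y z m] by auto
    \<comment> \<open>With \<open>a = h x - h z\<close> and \<open>b = h y - h z\<close>, the right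
      side minus the left side is \<open>(a + b)\<^sup>2\<close>.\<close>
    moreover have "q \<le> 2 * (h x - h z)\<^sup>2 + 2 * (h y - h z)\<^sup>2"
      unfolding q_def using zero_le_power2[of "(h x - h z) + (h y - h z)"]
      by (simp add: power2_eq_square algebra_simps)
    then have "ennreal q \<le> ennreal (2 * (h x - h z)\<^sup>2 + 2 * (h y - h z)\<^sup>2)"
      by (rule ennreal_leI)
    then have "ennreal q \<le> 2 * ennreal ((h x - h z)\<^sup>2) + 2 * ennreal ((h y - h z)\<^sup>2)"
      by (simp add: ennreal_plus ennreal_mult)
    ultimately show ?thesis
      using True by (simp add: indicator_def)
  qed auto
  then have "(\<integral>\<^sup>+z. ennreal q * indicator (ball m (r / 2)) z \<partial>lborel)
      \<le> (\<integral>\<^sup>+z. 2 * ?X z + 2 * ?Y z \<partial>lborel)"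
    by (intro nn_integral_mono)
  also have "\<dots> = (\<integral>\<^sup>+z. 2 * ?X z \<partial>lborel) + (\<integral>\<^sup>+z. 2 * ?Y z \<partial>lborel)"
    by (intro nn_integral_add; measurable)
  also have "(\<integral>\<^sup>+z. 2 * ?X z \<partial>lborel) = 2 * (\<integral>\<^sup>+z. ?X z \<partial>lborel)"
    by (intro nn_integral_cmult) measurable
  also have "(\<integral>\<^sup>+z. 2 * ?Y z \<partial>lborel) = 2 * (\<integral>\<^sup>+z. ?Y z \<partial>lborel)"
    by (intro nn_integral_cmult) measurable
  also have "(\<integral>\<^sup>+z. ennreal q * indicator (ball m (r / 2)) z \<partial>lborel) = ennreal q * ennreal V"
    using r by (simp add: nn_integral_cmult_indicator V_def emeasure_ball)
  finally have le: "ennreal q * ennreal V \<le> 2 * ((\<integral>\<^sup>+z. ?X z \<partial>lborel) + (\<integral>\<^sup>+z. ?Y z \<partial>lborel))"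
    by (simp add: distrib_left)
  \<comment> \<open>The factor 2 comes from the pointwise inequality and \<open>2 ^ DIM('a)\<close>
    from halving the radius in the volume \<open>V\<close> of the midpoint ball.\<close>
  have "2 / V = 2 * 2 ^ DIM('a) / unit_ball_vol DIM('a) * r powr (- real DIM('a))"
    using r by (simp add: V_def powr_minus powr_realpow field_simps)
  then have c: "ennreal (1 / V) * 2
      = ennreal (2 * 2 ^ DIM('a) / unit_ball_vol DIM('a)) * ennreal (r powr (- real DIM('a)))"
    using V by (simp add: ennreal_mult[symmetric] ennreal_mult''[symmetric] flip: ennreal_numeral)
  have "ennreal q = ennreal (1 / V) * (ennreal q * ennreal V)"
    using V by (simp add: ennreal_mult'[symmetric] ennreal_mult''[symmetric] q_def)
  also have "\<dots> \<le> ennreal (1 / V) * (2 * ((\<integral>\<^sup>+z. ?X z \<partial>lborel) + (\<integral>\<^sup>+z. ?Y z \<partial>lborel)))"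
    by (intro mult_left_mono le) auto
  also have "\<dots> = ennreal (2 * 2 ^ DIM('a) / unit_ball_vol DIM('a)) *
      (ennreal (r powr (- real DIM('a))) * (\<integral>\<^sup>+z. ?X z \<partial>lborel) +
       ennreal (r powr (- real DIM('a))) * (\<integral>\<^sup>+z. ?Y z \<partial>lborel))"
    unfolding mult.assoc[symmetric] c by (simp add: distrib_left mult.assoc)
  finally show ?thesis
    unfolding q_def r_def .
qed auto

text \<open>Averaging splits the integral into two terms, one for each tail bound. These bounds are
  assumed only almost everywhere because \<open>k\<close> will come from a Borel representative of
  the kernel, whose slices are controlled at almost every point.\<close>

lemma nn_integral_sq_diff_kernel_le:
  fixes h :: "'a::euclidean_space \<Rightarrow> real" and k :: "'a \<Rightarrow> 'a \<Rightarrow> ennreal" and s :: real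
  assumes [measurable]: "h \<in> borel_measurable borel" "case_prod k \<in> borel_measurable (borel \<Otimes>\<^sub>M borel)"
    and fst: "AE x in lborel. \<forall>r>0. (\<integral>\<^sup>+y\<in>- ball x r. k x y \<partial>lborel) \<le> L * ennreal (r powr (- 2 * s))"
    and snd: "AE y in lborel. \<forall>r>0. (\<integral>\<^sup>+x\<in>- ball y r. k x y \<partial>lborel) \<le> L * ennreal (r powr (- 2 * s))"
  shows "(\<integral>\<^sup>+x. \<integral>\<^sup>+y. ennreal ((h x - h y)\<^sup>2) * k x y \<partial>lborel \<partial>lborel)
    \<le> ennreal (4 * 2 ^ DIM('a) / unit_ball_vol DIM('a)) * L *
      (\<integral>\<^sup>+x. \<integral>\<^sup>+y. ennreal ((h x - h y)\<^sup>2) * ennreal (norm (x - y) powr (- (DIM('a) + 2 * s)))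
         \<partial>lborel \<partial>lborel)"
proof -
  define M where "M = ennreal (2 * 2 ^ DIM('a) / unit_ball_vol DIM('a))"
  define A where "A x y = ennreal (norm (x - y) powr (- real DIM('a))) *
      (\<integral>\<^sup>+z\<in>cball x (norm (x - y)). ennreal ((h x - h z)\<^sup>2) \<partial>lborel)" for x y
  define E where "E x = (\<integral>\<^sup>+y. ennreal ((h x - h y)\<^sup>2) *
      ennreal (norm (x - y) powr (- (DIM('a) + 2 * s))) \<partial>lborel)" for x
  \<comment> \<open>Again the moving ball is written as a condition on norms, here to make
    \<open>A\<close> measurable as a function of the pair.\<close>
  have A_eq: "A x y = ennreal (norm (x - y) powr (- real DIM('a))) *
      (\<integral>\<^sup>+z. ennreal ((h x - h z)\<^sup>2) * (if norm (x - z) \<le> norm (x - y) then 1 else 0) \<partial>lborel)" for x y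
    unfolding A_def by (intro arg_cong2[of _ _ _ _ "(*)"] refl nn_integral_cong)
      (auto simp: indicator_def dist_norm)
  have [measurable]: "case_prod A \<in> borel_measurable (borel \<Otimes>\<^sub>M borel)"
    unfolding A_eq by measurable
  have [measurable]: "E \<in> borel_measurable borel"
    unfolding E_def by measurable
  have pt: "ennreal ((h x - h y)\<^sup>2) \<le> M * (A x y + A y x)" for x y
    using sq_diff_le_average[of h x y] by (simp add: M_def A_def norm_minus_commute)
  have "(\<integral>\<^sup>+x. \<integral>\<^sup>+y. ennreal ((h x - h y)\<^sup>2) * k x y \<partial>lborel \<partial>lborel)
      \<le> (\<integral>\<^sup>+x. \<integral>\<^sup>+y. M * (k x y * A x y + k x y * A y x) \<partial>lborel \<partial>lborel)"
    using mult_right_mono[OF pt, of "k x y" x y for x y]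
    by (intro nn_integral_mono) (simp add: distrib_left mult_ac)
  also have "\<dots> = M * ((\<integral>\<^sup>+x. \<integral>\<^sup>+y. k x y * A x y \<partial>lborel \<partial>lborel) +
      (\<integral>\<^sup>+x. \<integral>\<^sup>+y. k x y * A y x \<partial>lborel \<partial>lborel))"
    by (simp add: nn_integral_add nn_integral_cmult)
  \<comment> \<open>In this term the ball is centred at \<open>y\<close>, so the integral over
    \<open>x\<close> has to be taken first for \<open>snd\<close> to apply.\<close>
  also have "(\<integral>\<^sup>+x. \<integral>\<^sup>+y. k x y * A y x \<partial>lborel \<partial>lborel) = (\<integral>\<^sup>+y. \<integral>\<^sup>+x. k x y * A y x \<partial>lborel \<partial>lborel)"
    by (intro lborel_pair.Fubini'[symmetric]) measurable
  also have "\<dots> \<le> (\<integral>\<^sup>+y. L * E y \<partial>lborel)"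
  proof (rule nn_integral_mono_AE, use snd in eventually_elim)
    fix y assume "\<forall>r>0. (\<integral>\<^sup>+x\<in>- ball y r. k x y \<partial>lborel) \<le> L * ennreal (r powr (- 2 * s))"
    then show "(\<integral>\<^sup>+x. k x y * A y x \<partial>lborel) \<le> L * E y"
      unfolding A_def E_def by (intro nn_integral_weighted_cball_le) (auto intro: measurable_Pair1)
  qed
  also have "(\<integral>\<^sup>+x. \<integral>\<^sup>+y. k x y * A x y \<partial>lborel \<partial>lborel) \<le> (\<integral>\<^sup>+x. L * E x \<partial>lborel)"
  proof (rule nn_integral_mono_AE, use fst in eventually_elim)
    fix x assume "\<forall>r>0. (\<integral>\<^sup>+y\<in>- ball x r. k x y \<partial>lborel) \<le> L * ennreal (r powr (- 2 * s))"
    then show "(\<integral>\<^sup>+y. k x y * A x y \<partial>lborel) \<le> L * E x"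
      unfolding A_def E_def by (intro nn_integral_weighted_cball_le) auto
  qed
  \<comment> \<open>Both terms have the same bound, which doubles the constant of
    \<open>sq_diff_le_average\<close>.\<close>
  also have "M * ((\<integral>\<^sup>+x. L * E x \<partial>lborel) + (\<integral>\<^sup>+x. L * E x \<partial>lborel)) = (M * 2) * L * (\<integral>\<^sup>+x. E x \<partial>lborel)"
    by (simp add: nn_integral_cmult mult_2[symmetric] mult_ac)
  also have "M * 2 = ennreal (4 * 2 ^ DIM('a) / unit_ball_vol DIM('a))"
    by (simp add: M_def ennreal_mult''[symmetric] flip: ennreal_numeral)
  finally show ?thesis
    unfolding E_def by (simp add: add_mono mult_left_mono)
qed

section \<open>Transfer to Lebesgue measurable kernels and functions\<close>

text \<open>The Borel estimate is applied to representatives \<open>h\<close> of \<open>g\<close>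
  and \<open>k\<close> of \<open>K\<close>, with \<open>\<bar>k\<bar>\<close> as the kernel. The
  factor 1/2 in \<open>Esym\<close> turns its constant 4 into 2.\<close>

lemma Esym_bound:
  fixes K :: "real^'n \<Rightarrow> real^'n \<Rightarrow> real" and g :: "real^'n \<Rightarrow> real"
  assumes K: "(\<lambda>(v, v'). K v v') \<in> borel_measurable lebesgue"
    and bounds: "kernel_bounds s \<Lambda> K" and g: "g \<in> Hs s"
  shows "Esym_defined K g g"
    and "Esym K g g \<le> 2 * 2 ^ CARD('n) / unit_ball_vol CARD('n) * max 0 \<Lambda> * (Hdot_norm s g)\<^sup>2"
proof -
  \<comment> \<open>\<open>max 0 \<Lambda>\<close> matches the truncation by \<open>ennreal\<close>
    in \<open>kernel_bounds\<close>, so the sign of \<open>\<Lambda>\<close> needs no case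
    distinction.\<close>
  define L where "L = max 0 \<Lambda>"
  define c where "c = 4 * 2 ^ CARD('n) / unit_ball_vol CARD('n)"
  have L: "L \<ge> 0" and c: "c \<ge> 0"
    by (simp_all add: L_def c_def)
  obtain k0 where k0: "k0 \<in> borel_measurable borel"
      and Kk0: "AE p in lborel. (case p of (v, v') \<Rightarrow> K v v') = k0 p"
    using completion_ex_borel_measurable_real[OF K] by auto
  define k where "k x y = k0 (x, y)" for x y
  obtain h where h[measurable]: "h \<in> borel_measurable borel" and gh: "AE v in lborel. g v = h v"
    using g completion_ex_borel_measurable_real[of g lborel] by (auto simp: Hs_def)
  have [measurable]: "case_prod k \<in> borel_measurable (borel \<Otimes>\<^sub>M borel)"
    using k0 by (simp add: k_def[abs_def] borel_prod)
  have Kk: "AE p in lborel \<Otimes>\<^sub>M lborel. K (fst p) (snd p) = k (fst p) (snd p)"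
    unfolding lborel_prod using Kk0 by eventually_elim (auto simp: k_def)
  have gh2: "AE p in (lborel :: ((real^'n) \<times> (real^'n)) measure). g (fst p) = h (fst p) \<and> g (snd p) = h (snd p)"
    by (rule lborel_AE_pair_fst_snd[OF gh])
  have bound: "ennreal (\<Lambda> * r powr (- 2 * s)) \<le> ennreal L * ennreal (r powr (- 2 * s))" for r
    by (subst ennreal_mult'[symmetric]) (auto simp: L_def intro!: ennreal_leI mult_right_mono)
  have Kbound1: "(\<integral>\<^sup>+y\<in>- ball x r. ennreal \<bar>K x y\<bar> \<partial>lebesgue) \<le> ennreal L * ennreal (r powr (- 2 * s))"
    and Kbound2: "(\<integral>\<^sup>+y\<in>- ball x r. ennreal \<bar>K y x\<bar> \<partial>lebesgue) \<le> ennreal L * ennreal (r powr (- 2 * s))"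
    if "r > 0" for x r
    by (rule order_trans[OF _ bound], use bounds that in \<open>simp add: kernel_bounds_def\<close>)+
  \<comment> \<open>For almost every \<open>x\<close> the slices of \<open>k\<close> and
    \<open>K\<close> at \<open>x\<close> agree almost everywhere, so at such \<open>x\<close> the
    bound for \<open>K\<close> passes to \<open>k\<close> for all radii at once.\<close>
  have bd1: "AE x in lborel. \<forall>r>0. (\<integral>\<^sup>+y\<in>- ball x r. ennreal \<bar>k x y\<bar> \<partial>lborel)
      \<le> ennreal L * ennreal (r powr (- 2 * s))"
    using lborel_pair.AE_pair[OF Kk]
  proof eventually_elim
    case (elim x)
    have "(\<integral>\<^sup>+y\<in>- ball x r. ennreal \<bar>k x y\<bar> \<partial>lborel) = (\<integral>\<^sup>+y\<in>- ball x r. ennreal \<bar>K x y\<bar> \<partial>lebesgue)" for r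
      unfolding nn_integral_completion
      by (rule nn_integral_cong_AE, use elim in eventually_elim) simp
    then show ?case
      using Kbound1 by simp
  qed
  have "AE p in lborel \<Otimes>\<^sub>M lborel. K (snd p) (fst p) = k (snd p) (fst p)"
    using lborel_AE_pair_swap[OF Kk] by simp
  from lborel_pair.AE_pair[OF this]
  have bd2: "AE y in lborel. \<forall>r>0. (\<integral>\<^sup>+x\<in>- ball y r. ennreal \<bar>k x y\<bar> \<partial>lborel)
      \<le> ennreal L * ennreal (r powr (- 2 * s))"
  proof eventually_elim
    case (elim y)
    have "(\<integral>\<^sup>+x\<in>- ball y r. ennreal \<bar>k x y\<bar> \<partial>lborel) = (\<integral>\<^sup>+x\<in>- ball y r. ennreal \<bar>K x y\<bar> \<partial>lebesgue)" for r
      unfolding nn_integral_completion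
      by (rule nn_integral_cong_AE, use elim in eventually_elim) simp
    then show ?case
      using Kbound2 by simp
  qed
  define H where "H = (LINT p|lebesgue. Hdot_integrand s g p)"
  have Hdot_nonneg: "Hdot_integrand s g p \<ge> 0" for p
    by (simp add: Hdot_integrand_def split_beta)
  have Hdot_eq: "Hdot_integrand s g p =
      (g (fst p) - g (snd p))\<^sup>2 * norm (fst p - snd p) powr (- (CARD('n) + 2 * s))" for p
    unfolding Hdot_integrand_def split_beta powr_minus divide_inverse by (simp add: power2_commute)
  have H0: "H \<ge> 0"
    unfolding H_def by (intro integral_nonneg_AE AE_I2 Hdot_nonneg)
  \<comment> \<open>The integrability contained in \<open>Hs\<close> ensures that \<open>H\<close>
    is the true value of the integral and not the default 0.\<close>
  have "(\<integral>\<^sup>+p. ennreal (Hdot_integrand s g p) \<partial>lebesgue) = ennreal H"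
    unfolding H_def using g
    by (intro nn_integral_eq_integral AE_I2 Hdot_nonneg) (simp add: Hs_def)
  then have H: "(\<integral>\<^sup>+p. ennreal (Hdot_integrand s g p) \<partial>lborel) = ennreal H"
    by (simp only: nn_integral_completion)
  have "(\<integral>\<^sup>+x. \<integral>\<^sup>+y. ennreal ((h x - h y)\<^sup>2) * ennreal (norm (x - y) powr (- (CARD('n) + 2 * s))) \<partial>lborel \<partial>lborel)
      = (\<integral>\<^sup>+p. ennreal ((h (fst p) - h (snd p))\<^sup>2) * ennreal (norm (fst p - snd p) powr (- (CARD('n) + 2 * s)))
          \<partial>(lborel \<Otimes>\<^sub>M lborel))"
    by (subst lborel.nn_integral_fst[symmetric]) simp_all
  also have "\<dots> = (\<integral>\<^sup>+p. ennreal (Hdot_integrand s g p) \<partial>lborel)"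
    unfolding lborel_prod
    by (rule nn_integral_cong_AE, use gh2 in eventually_elim)
       (simp add: Hdot_eq ennreal_mult')
  finally have HH: "(\<integral>\<^sup>+x. \<integral>\<^sup>+y. ennreal ((h x - h y)\<^sup>2) *
      ennreal (norm (x - y) powr (- (CARD('n) + 2 * s))) \<partial>lborel \<partial>lborel) = ennreal H"
    by (simp add: H)
  have main: "(\<integral>\<^sup>+x. \<integral>\<^sup>+y. ennreal ((h x - h y)\<^sup>2) * ennreal \<bar>k x y\<bar> \<partial>lborel \<partial>lborel)
      \<le> ennreal (c * L * H)"
    using nn_integral_sq_diff_kernel_le[OF h _ bd1 bd2] HH
    by (simp add: ennreal_mult L c H0 flip: c_def)
  \<comment> \<open>\<open>F\<close> is a Borel version of the integrand of \<open>Esym\<close>.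
    Completeness of Lebesgue measure carries its measurability over to the integrand itself.\<close>
  define F where "F p = (h (fst p) - h (snd p)) * (h (fst p) - h (snd p)) * k (fst p) (snd p)" for p
  have FE: "AE p in lborel. F p = Esym_integrand K g g p"
    using gh2 Kk unfolding lborel_prod
    by eventually_elim (auto simp: F_def Esym_integrand_def split_beta)
  have F: "F \<in> borel_measurable lborel"
    unfolding F_def lborel_prod[symmetric] by measurable
  have Em: "Esym_integrand K g g \<in> borel_measurable lebesgue"
    by (rule borel_measurable_AE[OF measurable_completion[OF F] AE_completion[OF FE]])
  \<comment> \<open>Since \<open>K\<close> may change sign, the absolute value is estimated; one
    finite bound then gives both integrability and the inequality for the signed integral.\<close>
  have "(\<integral>\<^sup>+p. ennreal (norm (Esym_integrand K g g p)) \<partial>lebesgue) = (\<integral>\<^sup>+p. ennreal \<bar>F p\<bar> \<partial>(lborel \<Otimes>\<^sub>M lborel))"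
    unfolding nn_integral_completion lborel_prod
    by (rule nn_integral_cong_AE, use FE in eventually_elim) simp
  also have "\<dots> = (\<integral>\<^sup>+x. \<integral>\<^sup>+y. ennreal ((h x - h y)\<^sup>2) * ennreal \<bar>k x y\<bar> \<partial>lborel \<partial>lborel)"
    using F unfolding lborel_prod[symmetric]
    by (subst lborel.nn_integral_fst[symmetric])
       (auto simp: F_def abs_mult ennreal_mult power2_eq_square intro!: nn_integral_cong)
  also note main
  finally have fin: "(\<integral>\<^sup>+p. ennreal (norm (Esym_integrand K g g p)) \<partial>lebesgue) \<le> ennreal (c * L * H)" .
  show def: "Esym_defined K g g"
    unfolding Esym_defined_def integrable_iff_bounded using Em fin le_less_trans[OF fin] by auto
  have "(LINT p|lebesgue. Esym_integrand K g g p) \<le> c * L * H"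
    using order_trans[OF integral_norm_bound_ennreal fin] def L c H0
    by (simp add: Esym_defined_def)
  then show "Esym K g g \<le> 2 * 2 ^ CARD('n) / unit_ball_vol CARD('n) * max 0 \<Lambda> * (Hdot_norm s g)\<^sup>2"
    using H0 by (simp add: Esym_def Hdot_norm_def H_def[symmetric] c_def L_def)
qed

theorem lemma4p2:
  fixes s \<Lambda> :: real
  assumes "0 < s" and "s < 1"
  shows "\<exists>C::real. \<forall>K :: real^'n \<Rightarrow> real^'n \<Rightarrow> real.
    (\<lambda>(v, v'). K v v') \<in> borel_measurable lebesgue \<longrightarrow> kernel_bounds s \<Lambda> K \<longrightarrow>
    (\<forall>g\<in>Hs s. Esym_defined K g g \<and> Esym K g g \<le> C * (Hdot_norm s g)\<^sup>2)"
  \<comment> \<open>The witness is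
    \<open>2 * 2 ^ CARD('n) / unit_ball_vol CARD('n) * max 0 \<Lambda>\<close>, in which neither
    \<open>K\<close> nor \<open>g\<close> occurs.\<close>
  using Esym_bound by blast

end
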